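(* Assume that $A$ is a standard graded Artinian algebra over a field $\mathsf{k}$ and that its Hilbert function $H(A)$ is unimodal. Then $A$ has an element of strong Lefschetz Jordan type if and only if $A$ has a strong Lefschetz element.
   Context: A standard graded Artinian algebra over $\mathsf{k}$ is a commutative graded ring $A=\bigoplus_{i=0}^{j}A_i$, with $A_0=\mathsf{k}$, finite dimensional over $\mathsf{k}$ and generated by $A_1$ over $A_0$; $\mathfrak{m}_A=\bigoplus_{i\ge1}A_i$. Its Hilbert function is $H(A)=(h_0,\dots,h_j)$, $h_i=\dim_{\mathsf{k}}A_i$; it is unimodal if $h_0\le\dots\le h_c\ge\dots\ge h_j$ for some $c$. For $\ell\in\mathfrak{m}_A$, the Jordan type $P_\ell$ is the partition of $\dim_{\mathsf{k}}A$ given by the Jordan block sizes of the multiplication map $m_\ell\colon A\to A$. $H(A)^\vee$ is the partition with parts $\#\{u\mid h_u\ge i\}$, $i=1,2,\dots,\max_uh_u$. An element $\ell\in\mathfrak{m}_A$ (possibly non-homogeneous) has strong Lefschetz Jordan type if $P_\ell=H(A)^\vee$. A linear form $\ell\in A_1$ is a strong Lefschetz element if the multiplication maps $\times\ell^b\colon A_i\to A_{i+b}$ have maximal rank for each degree $0\le i<j$ and each integer $b\ge0$. *)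

theory Defs
  imports "Jordan_Normal_Form.Jordan_Normal_Form"
begin

(* The ring is the whole type 'a, its k-algebra structure is given by scale, and
   A i is the i-th graded piece. A (Suc j), A (j + 2), ... are set to 0, so that
   A i is meaningful for every i; A j itself may or may not be 0. *)
locale standard_graded_artinian_algebra = vector_space scale
  for scale :: "'k::field \<Rightarrow> 'a::comm_ring_1 \<Rightarrow> 'a" +
  fixes A :: "nat \<Rightarrow> 'a set" and j :: nat
  assumes scale_mult_left: "scale c x * y = scale c (x * y)"
    and subspace_piece: "subspace (A i)"
    and piece_above: "i > j \<Longrightarrow> A i = {0}"
    and direct_sum: "\<exists>!a. (\<forall>i. a i \<in> A i) \<and> x = (\<Sum>i\<le>j. a i)"
    and mult_pieces: "x \<in> A i \<Longrightarrow> y \<in> A m \<Longrightarrow> x * y \<in> A (i + m)"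
    and piece_0: "A 0 = range (\<lambda>c. scale c 1)"
    and finite_dimensional: "\<exists>B. finite B \<and> span B = UNIV"
    and generated_in_degree_1:
      "(\<lambda>S. subspace S \<and> 1 \<in> S \<and> (\<forall>x\<in>S. \<forall>y\<in>S. x * y \<in> S)) hull A 1 = UNIV"

definition maximal_ideal :: "(nat \<Rightarrow> 'a::comm_ring_1 set) \<Rightarrow> nat \<Rightarrow> 'a set" where
  "maximal_ideal A j = {\<Sum>i=1..j. a i | a. \<forall>i\<in>{1..j}. a i \<in> A i}"

definition hilbert_function ::
  "('k::field \<Rightarrow> 'a::comm_ring_1 \<Rightarrow> 'a) \<Rightarrow> (nat \<Rightarrow> 'a set) \<Rightarrow> nat \<Rightarrow> nat" where
  "hilbert_function scale A i = vector_space.dim scale (A i)"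

definition unimodal :: "(nat \<Rightarrow> nat) \<Rightarrow> nat \<Rightarrow> bool" where
  "unimodal h j \<longleftrightarrow> (\<exists>c\<le>j. (\<forall>u v. u \<le> v \<and> v \<le> c \<longrightarrow> h u \<le> h v) \<and>
                         (\<forall>u v. c \<le> u \<and> u \<le> v \<and> v \<le> j \<longrightarrow> h v \<le> h u))"

definition conjugate_partition :: "(nat \<Rightarrow> nat) \<Rightarrow> nat \<Rightarrow> nat multiset" where
  "conjugate_partition h j =
     image_mset (\<lambda>i. card {u. u \<le> j \<and> i \<le> h u}) (mset_set {1..Max (h ` {..j})})"

definition is_basis_list :: "('k::field \<Rightarrow> 'a::ab_group_add \<Rightarrow> 'a) \<Rightarrow> 'a list \<Rightarrow> bool" where
  "is_basis_list scale bs \<longleftrightarrow> distinct bs \<and> \<not> module.dependent scale (set bs) \<and>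
     module.span scale (set bs) = UNIV"

definition matrix_of ::
  "('k::field \<Rightarrow> 'a::ab_group_add \<Rightarrow> 'a) \<Rightarrow> 'a list \<Rightarrow> ('a \<Rightarrow> 'a) \<Rightarrow> 'k mat" where
  "matrix_of scale bs f = mat (length bs) (length bs)
     (\<lambda>(r, c). module.representation scale (set bs) (f (bs ! c)) (bs ! r))"

(* A relation rather than a function, since a Jordan form over k need not exist for
   arbitrary f; where it exists, P is unique. *)
definition has_jordan_type ::
  "('k::field \<Rightarrow> 'a::ab_group_add \<Rightarrow> 'a) \<Rightarrow> ('a \<Rightarrow> 'a) \<Rightarrow> nat multiset \<Rightarrow> bool" where
  "has_jordan_type scale f P \<longleftrightarrow>
     (\<exists>bs n_as. is_basis_list scale bs \<and> jordan_nf (matrix_of scale bs f) n_as \<and>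
        P = mset (map fst n_as))"

definition has_strong_lefschetz_jordan_type ::
  "('k::field \<Rightarrow> 'a::comm_ring_1 \<Rightarrow> 'a) \<Rightarrow> (nat \<Rightarrow> 'a set) \<Rightarrow> nat \<Rightarrow> 'a \<Rightarrow> bool" where
  "has_strong_lefschetz_jordan_type scale A j l \<longleftrightarrow>
     l \<in> maximal_ideal A j \<and>
     has_jordan_type scale ((*) l) (conjugate_partition (hilbert_function scale A) j)"

definition strong_lefschetz_element ::
  "('k::field \<Rightarrow> 'a::comm_ring_1 \<Rightarrow> 'a) \<Rightarrow> (nat \<Rightarrow> 'a set) \<Rightarrow> nat \<Rightarrow> 'a \<Rightarrow> bool" where
  "strong_lefschetz_element scale A j l \<longleftrightarrow>
     l \<in> A 1 \<and>
     (\<forall>i<j. \<forall>b. vector_space.dim scale ((\<lambda>x. l ^ b * x) ` A i) =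
        min (vector_space.dim scale (A i)) (vector_space.dim scale (A (i + b))))"

end

theory Submission
  imports Defs "Jordan_Normal_Form.Jordan_Normal_Form_Existence"
    "Jordan_Normal_Form.Jordan_Normal_Form_Uniqueness"
begin

text \<open>
Write \<open>h\<close> for the Hilbert function. The Jordan type of a nilpotent operator \<open>f\<close> is determined by
the numbers \<open>dim (ker f\<^sup>b)\<close>, since a partition \<open>P\<close> is the Jordan type exactly when
\<open>dim (ker f\<^sup>b)\<close> is the sum of \<open>min b p\<close> over the parts \<open>p\<close> of \<open>P\<close>, for every \<open>b\<close>
(\<open>has_jordan_type_nilpotent_iff\<close>). For the conjugate of a unimodal \<open>h\<close> this sum is
\<open>\<Sum>u\<le>j. h u - h (u + b)\<close> with truncated subtraction, because the superlevel sets of \<open>h\<close> are intervals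
(\<open>conjugate_partition_truncated_sum\<close>). So \<open>l\<close> has strong Lefschetz Jordan type iff the kernel of
every power \<open>l\<^sup>b\<close> has that dimension (\<open>strong_lefschetz_jordan_type_iff\<close>).

If \<open>l\<close> is a strong Lefschetz linear form, then the kernel of \<open>l\<^sup>b\<close> is graded, and in degree \<open>u\<close> it has
dimension \<open>h u - min (h u) (h (u + b)) = h u - h (u + b)\<close>. Adding up over \<open>u\<close> shows that \<open>l\<close> itself
has strong Lefschetz Jordan type.

Conversely let \<open>l\<close>, possibly not homogeneous, have strong Lefschetz Jordan type, let \<open>l\<^sub>1\<close> be its linear
part and let \<open>b > 0\<close>. Unimodality gives a degree \<open>t\<close> such that \<open>h u \<le> h (u + b)\<close> below \<open>t\<close> and
\<open>h u \<ge> h (u + b)\<close> from \<open>t\<close> on. Let \<open>filt i\<close> be the sum of the pieces of degree at least \<open>i\<close>. The given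
dimension of \<open>ker l\<^sup>b\<close> is \<open>dim (filt t) - dim (filt (t + b))\<close>, which is the least possible dimension for the
kernel of the restriction of \<open>l\<^sup>b\<close> to \<open>filt t \<rightarrow> filt (t + b)\<close>. Hence this restriction is onto and
\<open>ker l\<^sup>b\<close> lies in \<open>filt t\<close> (\<open>extremal_kernel_and_image\<close>). Passing to leading forms, \<open>l\<^sub>1\<^sup>b\<close> maps
\<open>A t\<close> onto \<open>A (t + b)\<close>, and then \<open>A i\<close> onto \<open>A (i + b)\<close> for all \<open>i \<ge> t\<close> since \<open>A\<close> is generated in
degree one. It is injective on \<open>A (t - 1)\<close>: if it kills \<open>x\<close> there, then \<open>l\<^sup>b x\<close> lies in
\<open>filt (t + b)\<close>, the image of \<open>filt t\<close>, so that \<open>x\<close> lies in \<open>filt t + ker l\<^sup>b = filt t\<close> and vanishes. If it killed a nonzero \<open>x\<close> of lower degree, multiplying by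
linear forms would lead either to a nonzero kernel element in degree \<open>t - 1\<close>, or to a nonzero
element of degree below \<open>t\<close> which is annihilated by all linear forms and thus by \<open>l\<close>, although it is
not in \<open>filt t\<close>. Both are impossible, so \<open>l\<^sub>1\<close> is a strong Lefschetz element.
\<close>

section \<open>Jordan types of nilpotent operators\<close>

context finite_dimensional_vector_space
begin

lemma rank_nullity_subspace:
  assumes f: "Vector_Spaces.linear scale scale f" and S: "subspace S"
  shows "dim {x \<in> S. f x = 0} + dim (f ` S) = dim S"
proof -
  interpret f: Vector_Spaces.linear scale scale f by (rule f)
  interpret P: finite_dimensional_vector_space_pair_1 scale Basis scale ..
  let ?K = "{x \<in> S. f x = 0}"
  obtain B where B: "B \<subseteq> ?K" "independent B" "?K \<subseteq> span B" "card B = dim ?K"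
    by (rule basis_exists)
  obtain C where C: "B \<subseteq> C" "C \<subseteq> S" "independent C" "S \<subseteq> span C"
    using maximal_independent_subset_extend[of B S] B by blast
  have fC: "finite C" using C(3) by (rule finiteI_independent)
  let ?D = "C - B"
  have D: "independent ?D" using C(3) by (rule independent_mono) auto
  have dims: "dim (span B) = card B" "dim (span ?D) = card ?D" "dim (span C) = card C"
    by (intro dim_span_eq_card_independent B D C)+
  have BD: "{x + y |x y. x \<in> span B \<and> y \<in> span ?D} = span C"
    using span_Un[of B ?D] Un_absorb1[OF C(1)] by (simp add: Un_Diff_cancel)
  have "card C + dim (span B \<inter> span ?D) = card B + card ?D"
    using dim_sums_Int[OF subspace_span subspace_span, of B ?D] unfolding BD dims .
  moreover have card: "card C = card B + card ?D"
    using card_mono[OF fC C(1)] card_Diff_subset[OF finite_subset[OF C(1) fC] C(1)] by simp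
  ultimately have "dim (span B \<inter> span ?D) = 0" by simp
  then have int: "span B \<inter> span ?D \<subseteq> {0}" by simp
  have KB: "span B = ?K"
  proof
    have "subspace ?K"
      using S by (auto simp: subspace_def f.add f.scale)
    then show "span B \<subseteq> ?K" using B(1) by (rule span_minimal[rotated])
  qed (rule B)
  have SC: "span C = S" using span_minimal[OF C(2) S] C(4) by (rule equalityI)
  have "span ?D \<subseteq> S" using C(2) S by (intro span_minimal) auto
  then have ker: "x = 0" if "x \<in> span ?D" "f x = 0" for x
    using that KB int by auto
  have inj: "inj_on f (span ?D)"
  proof (rule inj_onI)
    fix x y assume "x \<in> span ?D" "y \<in> span ?D" "f x = f y"
    then have "x - y \<in> span ?D" "f (x - y) = 0" by (auto simp: f.diff span_diff)
    then have "x - y = 0" by (rule ker)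
    then show "x = y" by simp
  qed
  have "f ` S = f ` span ?D"
  proof
    show "f ` S \<subseteq> f ` span ?D"
    proof
      fix y assume "y \<in> f ` S"
      then obtain x where x: "y = f x" "x \<in> span C" using SC by auto
      then obtain u v where "x = u + v" "u \<in> span B" "v \<in> span ?D" using BD by blast
      then show "y \<in> f ` span ?D" using KB x(1) by (auto simp: f.add)
    qed
  qed (use \<open>span ?D \<subseteq> S\<close> in auto)
  then have "dim (f ` S) = card ?D"
    using P.dim_image_eq[OF f, of "span ?D"] inj dims by (simp add: span_span)
  then show ?thesis using card dims SC B(4) by simp
qed

lemma linear_funpow:
  assumes f: "Vector_Spaces.linear scale scale f"
  shows "Vector_Spaces.linear scale scale (f ^^ k)"
proof (induction k)
  case 0 show ?case using linear_id by (simp add: id_def)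
next
  case (Suc k) then show ?case using Vector_Spaces.linear_compose[OF Suc f] by (simp add: o_def)
qed

lemma subspace_kernel_funpow:
  assumes f: "Vector_Spaces.linear scale scale f"
  shows "subspace {x. (f ^^ k) x = 0}"
proof -
  interpret Vector_Spaces.linear scale scale "f ^^ k" by (rule linear_funpow[OF f])
  show ?thesis by (rule subspace_kernel)
qed

text \<open>Extend bases successively along the flag \<open>ker f \<subseteq> ker f\<^sup>2 \<subseteq> \<dots>\<close>. As \<open>f\<close> maps
each member of the flag into the preceding one, the image of a basis vector lies in the span of
earlier ones. This makes the matrix of \<open>f\<close> upper triangular over an arbitrary field.\<close>
lemma nilpotent_triangular_basis:
  assumes f: "Vector_Spaces.linear scale scale f" and nil: "\<And>x. (f ^^ k) x = 0"
  obtains bs where "is_basis_list scale bs"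
    and "\<And>c. c < length bs \<Longrightarrow> f (bs ! c) \<in> span (set (take c bs))"
proof -
  have "\<exists>bs. distinct bs \<and> independent (set bs) \<and> span (set bs) = {x. (f ^^ m) x = 0} \<and>
          (\<forall>c < length bs. f (bs ! c) \<in> span (set (take c bs)))" for m
  proof (induction m)
    case 0
    show ?case by (rule exI[of _ "[]"]) (auto simp: independent_empty)
  next
    case (Suc m)
    then obtain bs where bs: "distinct bs" "independent (set bs)"
      "span (set bs) = {x. (f ^^ m) x = 0}"
      "\<forall>c < length bs. f (bs ! c) \<in> span (set (take c bs))" by blast
    let ?K = "{x. (f ^^ Suc m) x = 0}"
    interpret f: Vector_Spaces.linear scale scale f by (rule f)
    have "set bs \<subseteq> ?K" using bs(3) span_superset[of "set bs"] by auto
    then obtain C where C: "set bs \<subseteq> C" "C \<subseteq> ?K" "independent C" "?K \<subseteq> span C"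
      using maximal_independent_subset_extend[of "set bs" ?K] bs(2) by blast
    obtain cs where cs: "set cs = C - set bs" "distinct cs"
      using finite_distinct_list[of "C - set bs"] finiteI_independent[OF C(3)] by auto
    have set: "set (bs @ cs) = C" using cs(1) C(1) by auto
    have "f ((bs @ cs) ! c) \<in> span (set (take c (bs @ cs)))" if c: "c < length (bs @ cs)" for c
    proof (cases "c < length bs")
      case True
      then show ?thesis using bs(4) by (simp add: nth_append)
    next
      case False
      have "(bs @ cs) ! c \<in> ?K" using c C(2) set nth_mem by blast
      then have "f ((bs @ cs) ! c) \<in> span (set bs)"
        unfolding bs(3) by (simp add: funpow_swap1)
      moreover have "set bs \<subseteq> set (take c (bs @ cs))" using False by simp
      ultimately show ?thesis using span_mono by blast
    qed
    moreover have "span (set (bs @ cs)) = ?K"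
      unfolding set using C(2,4) span_minimal[OF C(2) subspace_kernel_funpow[OF f]] by blast
    ultimately show ?case
      using bs(1) cs C(3) set by (intro exI[of _ "bs @ cs"]) auto
  qed
  from this[of k] show ?thesis using that nil by (auto simp: is_basis_list_def)
qed

definition coords :: "'b list \<Rightarrow> 'b \<Rightarrow> 'a vec" where
  "coords bs x = vec (length bs) (\<lambda>i. representation (set bs) x (bs ! i))"

context
  fixes bs :: "'b list"
  assumes bs: "is_basis_list scale bs"
begin

lemma basis_list: "distinct bs" "independent (set bs)" "span (set bs) = UNIV"
  using bs by (auto simp: is_basis_list_def)

lemma length_basis_list: "length bs = dim UNIV"
  using basis_list by (metis dim_span_eq_card_independent distinct_card)

lemma coords_carrier [simp]: "coords bs x \<in> carrier_vec (length bs)"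
  by (simp add: coords_def)

lemma expand_in_basis_list:
  "x = (\<Sum>c<length bs. scale (representation (set bs) x (bs ! c)) (bs ! c))"
proof -
  have "x = (\<Sum>b\<in>set bs. scale (representation (set bs) x b) b)"
    using basis_list by (subst sum_representation_eq) auto
  also have "\<dots> = (\<Sum>c<length bs. scale (representation (set bs) x (bs ! c)) (bs ! c))"
    using bij_betw_nth[OF basis_list(1) refl refl]
    by (subst sum.reindex_bij_betw[symmetric]) auto
  finally show ?thesis .
qed

lemma coords_sum:
  "coords bs (\<Sum>x\<in>X. scale (c x) x) = vec (length bs) (\<lambda>i. \<Sum>x\<in>X. c x * coords bs x $ i)"
  using basis_list
  by (auto simp: coords_def representation_sum representation_scale intro!: eq_vecI)

lemma coords_eq_0_iff: "coords bs x = 0\<^sub>v (length bs) \<longleftrightarrow> x = 0"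
proof
  assume "coords bs x = 0\<^sub>v (length bs)"
  then have "representation (set bs) x (bs ! c) = 0" if "c < length bs" for c
    using that by (metis coords_def index_vec index_zero_vec(1))
  then show "x = 0" by (subst expand_in_basis_list) simp
qed (auto simp: coords_def representation_zero)

lemma coords_surj:
  assumes "v \<in> carrier_vec (length bs)"
  obtains x where "v = coords bs x"
proof
  let ?c = "\<lambda>b. \<Sum>i<length bs. if bs ! i = b then v $ i else 0"
  have c: "?c (bs ! i) = v $ i" if "i < length bs" for i
    using that basis_list(1) by (simp add: nth_eq_iff_index_eq sum.delta cong: if_cong)
  have "representation (set bs) (\<Sum>b\<in>set bs. scale (?c b) b) (bs ! i) = ?c (bs ! i)"
    if "i < length bs" for i
  proof -
    have "representation (set bs) (\<Sum>b\<in>set bs. scale (?c b) b) (bs ! i) =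
       (\<Sum>b\<in>set bs. ?c b * (if bs ! i = b then 1 else 0))"
      using basis_list that
      by (subst representation_sum)
        (auto simp: representation_scale representation_basis intro!: sum.cong)
    also have "\<dots> = (\<Sum>b\<in>set bs. if bs ! i = b then ?c b else 0)"
      by (intro sum.cong) auto
    also have "\<dots> = ?c (bs ! i)" using that by (subst sum.delta') auto
    finally show ?thesis .
  qed
  then show "v = coords bs (\<Sum>b\<in>set bs. scale (?c b) b)"
    using assms c by (intro eq_vecI) (auto simp: coords_def)
qed

lemma matrix_of_mult_coords:
  assumes f: "Vector_Spaces.linear scale scale f"
  shows "matrix_of scale bs f *\<^sub>v coords bs x = coords bs (f x)"
proof (rule eq_vecI)
  interpret f: Vector_Spaces.linear scale scale f by (rule f)
  let ?n = "length bs" and ?rep = "representation (set bs)"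
  fix r assume "r < dim_vec (coords bs (f x))"
  then have r: "r < ?n" by (simp add: coords_def)
  have "f x = (\<Sum>c<?n. scale (?rep x (bs ! c)) (f (bs ! c)))"
    by (subst expand_in_basis_list) (simp add: f.sum f.scale)
  then have "?rep (f x) (bs ! r) = (\<Sum>c<?n. ?rep (f (bs ! c)) (bs ! r) * ?rep x (bs ! c))"
    using basis_list by (simp add: representation_sum representation_scale mult.commute)
  then show "(matrix_of scale bs f *\<^sub>v coords bs x) $ r = coords bs (f x) $ r"
    using r by (simp add: matrix_of_def coords_def scalar_prod_def lessThan_atLeast0)
qed (simp add: coords_def matrix_of_def)

lemma matrix_of_carrier: "matrix_of scale bs f \<in> carrier_mat (length bs) (length bs)"
  by (simp add: matrix_of_def)

lemma matrix_of_power_mult_coords: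
  assumes f: "Vector_Spaces.linear scale scale f"
  shows "(matrix_of scale bs f ^\<^sub>m k) *\<^sub>v coords bs x = coords bs ((f ^^ k) x)"
proof (induction k arbitrary: x)
  case 0 then show ?case by (simp add: matrix_of_def)
next
  case (Suc k)
  have "(matrix_of scale bs f ^\<^sub>m Suc k) *\<^sub>v coords bs x =
      (matrix_of scale bs f ^\<^sub>m k) *\<^sub>v (matrix_of scale bs f *\<^sub>v coords bs x)"
    by (simp add: assoc_mult_mat_vec[OF pow_carrier_mat[OF matrix_of_carrier] matrix_of_carrier])
  also have "\<dots> = coords bs ((f ^^ Suc k) x)"
    by (simp add: matrix_of_mult_coords[OF f] Suc funpow_swap1)
  finally show ?case .
qed

text \<open>The bridge between the two notions of dimension: taking coordinates is a linear
bijection from the kernel of the operator onto the kernel of its matrix, and so it carries a basis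
of the former to a basis of the latter.\<close>
lemma kernel_dim_eq_dim:
  assumes M: "M \<in> carrier_mat (length bs) (length bs)"
    and Mg: "\<And>x. M *\<^sub>v coords bs x = coords bs (g x)"
    and K: "subspace {x. g x = 0}"
  shows "kernel_dim M = dim {x. g x = 0}"
proof -
  let ?n = "length bs" and ?K = "{x. g x = 0}"
  interpret ker: kernel ?n ?n M using M by unfold_locales
  obtain B where B: "B \<subseteq> ?K" "independent B" "?K \<subseteq> span B" "card B = dim ?K"
    by (rule basis_exists)
  have finB: "finite B" using B(2) by (rule finiteI_independent)
  have mk: "mat_kernel M = coords bs ` ?K"
  proof
    show "mat_kernel M \<subseteq> coords bs ` ?K"
    proof
      fix v assume v: "v \<in> mat_kernel M"
      then obtain x where x: "v = coords bs x"
        using coords_surj mat_kernelD(1)[OF M] by metis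
      then have "coords bs (g x) = 0\<^sub>v ?n" using mat_kernelD(2)[OF M v] Mg by simp
      then show "v \<in> coords bs ` ?K" using x coords_eq_0_iff by auto
    qed
    show "coords bs ` ?K \<subseteq> mat_kernel M"
      using coords_eq_0_iff by (auto intro!: mat_kernelI[OF M] simp: Mg)
  qed
  have inj: "inj (coords bs)"
  proof (rule injI)
    fix x y assume eq: "coords bs x = coords bs y"
    have "representation (set bs) x (bs ! c) = representation (set bs) y (bs ! c)"
      if "c < ?n" for c
      using that eq by (metis coords_def index_vec)
    then show "x = y" by (subst (1 2) expand_in_basis_list) simp
  qed
  have lin: "ker.lincomb a (coords bs ` U) = coords bs (\<Sum>u\<in>U. scale (a (coords bs u)) u)"
    if U: "U \<subseteq> B" for U a
  proof -
    have sub: "coords bs ` U \<subseteq> mat_kernel M" using U B(1) mk by auto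
    have "ker.lincomb a (coords bs ` U) \<in> mat_kernel M"
      using sub by (intro ker.Ker.lincomb_closed) auto
    then have "dim_vec (ker.lincomb a (coords bs ` U)) = ?n"
      using mat_kernelD(1)[OF M] by auto
    then show ?thesis
      using inj_on_subset[OF inj subset_UNIV, of U]
      by (intro eq_vecI) (simp_all add: coords_sum ker.lincomb_index[OF _ sub] sum.reindex)
  qed
  have "\<not> ker.lin_dep (coords bs ` B)"
  proof
    assume "ker.lin_dep (coords bs ` B)"
    then obtain V a v where V: "finite V" "V \<subseteq> coords bs ` B" "ker.lincomb a V = 0\<^sub>v ?n"
      "v \<in> V" "a v \<noteq> 0"
      unfolding ker.Ker.lin_dep_def by auto
    then obtain U where U: "U \<subseteq> B" "V = coords bs ` U" by (meson subset_image_iff)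
    then have "(\<Sum>u\<in>U. scale (a (coords bs u)) u) = 0"
      using V(3) lin[OF U(1), of a] coords_eq_0_iff unfolding U(2) by simp
    then have "a (coords bs u) = 0" if "u \<in> U" for u
      using that U(1) finB B(2) independentD[OF B(2), of U "\<lambda>u. a (coords bs u)" u]
      by (auto dest: finite_subset)
    then show False using V(4,5) U(2) by auto
  qed
  moreover have "ker.span (coords bs ` B) = mat_kernel M"
  proof -
    have "ker.span (coords bs ` B) \<subseteq> mat_kernel M"
      using B(1) mk by (intro ker.Ker.span_is_subset2) auto
    moreover have "mat_kernel M \<subseteq> ker.span (coords bs ` B)"
    proof
      fix v assume "v \<in> mat_kernel M"
      obtain x where x: "v = coords bs x" "x \<in> ?K" using \<open>v \<in> mat_kernel M\<close> mk by auto
      \<comment> \<open>the coefficients of \<open>x\<close> in \<open>B\<close>, indexed by the coordinate vectors of \<open>B\<close>\<close>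
      let ?a = "\<lambda>w. representation B x (inv_into UNIV (coords bs) w)"
      have "(\<Sum>b\<in>B. scale (representation B x b) b) = x"
        using x B finB by (intro sum_representation_eq) auto
      then have "v = ker.lincomb ?a (coords bs ` B)"
        using lin[of B ?a] x inj by simp
      then show "v \<in> ker.span (coords bs ` B)" unfolding ker.Ker.span_def using finB by auto
    qed
    ultimately show ?thesis by (rule equalityI)
  qed
  moreover have "coords bs ` B \<subseteq> mat_kernel M"
    using image_mono[OF B(1), of "coords bs"] unfolding mk[symmetric] .
  ultimately have "ker.basis (coords bs ` B)"
    unfolding ker.Ker.basis_def by (intro conjI)
  then have "ker.dim = card (coords bs ` B)"
    by (rule ker.Ker.dim_basis[OF finite_imageI[OF finB]])
  also have "\<dots> = dim ?K" using B(4) card_image inj inj_on_subset by (metis subset_UNIV)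
  finally show ?thesis by simp
qed

lemma dim_gen_eigenspace_matrix_of:
  assumes f: "Vector_Spaces.linear scale scale f"
  shows "dim_gen_eigenspace (matrix_of scale bs f) 0 k = dim {x. (f ^^ k) x = 0}"
proof -
  have "char_matrix (matrix_of scale bs f) 0 = matrix_of scale bs f"
    by (auto simp: char_matrix_def matrix_of_def intro!: eq_matI)
  then show ?thesis
    unfolding dim_gen_eigenspace_def
    using kernel_dim_eq_dim[OF pow_carrier_mat[OF matrix_of_carrier]
        matrix_of_power_mult_coords[OF f] subspace_kernel_funpow[OF f], of k] by simp
qed

end

lemma jordan_nf_nilpotent_exists:
  assumes f: "Vector_Spaces.linear scale scale f" and nil: "\<And>x. (f ^^ k) x = 0"
  shows "\<exists>P. has_jordan_type scale f P"
proof -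
  obtain bs where bs: "is_basis_list scale bs"
    and tri: "\<And>c. c < length bs \<Longrightarrow> f (bs ! c) \<in> span (set (take c bs))"
    using nilpotent_triangular_basis[OF f nil] by blast
  note basis_list = basis_list[OF bs]
  have "upper_triangular (matrix_of scale bs f)"
  proof (rule upper_triangularI)
    fix r c assume cr: "c < r" and "r < dim_row (matrix_of scale bs f)"
    then have r: "r < length bs" by (simp add: matrix_of_def)
    have sub: "set (take c bs) \<subseteq> set bs" by (rule set_take_subset)
    have "representation (set bs) (f (bs ! c)) = representation (set (take c bs)) (f (bs ! c))"
      using tri[of c] cr r basis_list sub by (intro representation_extend) auto
    moreover have "bs ! r \<notin> set (take c bs)"
      using cr r basis_list(1) by (auto simp: in_set_conv_nth nth_eq_iff_index_eq)
    then have "representation (set (take c bs)) (f (bs ! c)) (bs ! r) = 0"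
      using representation_ne_zero by blast
    ultimately show "matrix_of scale bs f $$ (r, c) = 0"
      using cr r by (simp add: matrix_of_def)
  qed
  from triangular_to_jnf_vector[OF matrix_of_carrier[OF bs] this] show ?thesis
    using bs unfolding has_jordan_type_def by blast
qed

text \<open>Blocks of eigenvalue \<open>0\<close> and size \<open>n\<close> contribute \<open>min b n\<close> to the kernel of the
\<open>b\<close>-th power. Applied to a vanishing power, this shows that these blocks already fill the whole
space, so that there are no blocks for other eigenvalues.\<close>
lemma jordan_type_nilpotentD:
  assumes f: "Vector_Spaces.linear scale scale f" and nil: "\<And>x. (f ^^ k) x = 0"
    and P: "has_jordan_type scale f P"
  shows "0 \<notin># P" and "(\<Sum>p\<in>#P. min b p) = dim {x. (f ^^ b) x = 0}"
proof -
  obtain bs n_as where bs: "is_basis_list scale bs"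
    and jnf: "jordan_nf (matrix_of scale bs f) n_as" and P: "P = mset (map fst n_as)"
    using P unfolding has_jordan_type_def by blast
  let ?Z = "filter (\<lambda>(n, e). e = 0) n_as" and ?Z' = "filter (\<lambda>x. \<not> (case x of (n, e) \<Rightarrow> e = 0)) n_as"
  show "0 \<notin># P" using jnf P by (force simp: jordan_nf_def)
  have dims: "dim {x. (f ^^ m) x = 0} = (\<Sum>n\<leftarrow>map fst ?Z. min m n)" for m
    using dim_gen_eigenspace[OF jnf] dim_gen_eigenspace_matrix_of[OF bs f] by metis
  have "dim UNIV = (\<Sum>n\<leftarrow>map fst ?Z. min k n)" using dims[of k] nil by simp
  also have "\<dots> \<le> (\<Sum>n\<leftarrow>map fst ?Z. n)" by (rule sum_list_mono) simp
  finally have le: "dim UNIV \<le> sum_list (map fst ?Z)" by simp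
  have "similar_mat (matrix_of scale bs f) (jordan_matrix n_as)"
    using jnf by (simp add: jordan_nf_def)
  then obtain n where "matrix_of scale bs f \<in> carrier_mat n n" "jordan_matrix n_as \<in> carrier_mat n n"
    unfolding similar_mat_def similar_mat_wit_def Let_def by blast
  then have "length bs = sum_list (map fst n_as)"
    using matrix_of_carrier[OF bs, of f] jordan_matrix_dim(1)[of n_as] by (metis carrier_matD(1))
  also have "\<dots> = sum_list (map fst ?Z) + sum_list (map fst ?Z')"
    by (induction n_as) auto
  finally have "sum_list (map fst ?Z') = 0"
    using le length_basis_list[OF bs] by simp
  then have "\<forall>x\<in>set ?Z'. fst x = 0" by (simp add: sum_list_eq_0_iff)
  then have "?Z = n_as"
    using jnf by (force simp: jordan_nf_def filter_id_conv image_iff)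
  then show "(\<Sum>p\<in>#P. min b p) = dim {x. (f ^^ b) x = 0}"
    using dims[of b] P by (simp add: image_mset.compositionality flip: sum_mset_sum_list)
qed

end

text \<open>The successive differences of the truncated sums count the parts larger than \<open>b\<close>;
the differences of these counts are the multiplicities.\<close>
lemma multiset_eq_if_truncated_sums_eq:
  fixes P Q :: "nat multiset"
  assumes 0: "0 \<notin># P" "0 \<notin># Q" and eq: "\<And>b. (\<Sum>p\<in>#P. min b p) = (\<Sum>p\<in>#Q. min b p)"
  shows "P = Q"
proof (rule multiset_eqI)
  have step: "(\<Sum>p\<in>#R. min (Suc b) p) = (\<Sum>p\<in>#R. min b p) + size {#p \<in># R. b < p#}"
    for R :: "nat multiset" and b
    by (induction R) auto
  have tail: "size {#p \<in># P. b < p#} = size {#p \<in># Q. b < p#}" for b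
    using step[of b P] step[of b Q] eq[of b] eq[of "Suc b"] by simp
  have count: "size {#p \<in># R. b < p#} = count R (Suc b) + size {#p \<in># R. Suc b < p#}"
    for R :: "nat multiset" and b
    by (induction R) auto
  fix p show "count P p = count Q p"
  proof (cases p)
    case 0
    then show ?thesis using assms by (metis count_inI)
  next
    case (Suc b)
    then show ?thesis using count[of b P] count[of b Q] tail[of b] tail[of "Suc b"] by simp
  qed
qed

text \<open>Over an arbitrary field: a nilpotent operator has a Jordan form by the triangular
basis, and its partition is the only one that has the prescribed truncated sums.\<close>
theorem (in finite_dimensional_vector_space) has_jordan_type_nilpotent_iff:
  assumes f: "Vector_Spaces.linear scale scale f" and nil: "\<And>x. (f ^^ k) x = 0"
  shows "has_jordan_type scale f P \<longleftrightarrow>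
    0 \<notin># P \<and> (\<forall>b. (\<Sum>p\<in>#P. min b p) = dim {x. (f ^^ b) x = 0})"
proof
  assume "0 \<notin># P \<and> (\<forall>b. (\<Sum>p\<in>#P. min b p) = dim {x. (f ^^ b) x = 0})"
  moreover obtain Q where Q: "has_jordan_type scale f Q"
    using jordan_nf_nilpotent_exists[OF f nil] by blast
  ultimately have "P = Q"
    using jordan_type_nilpotentD[OF f nil Q] by (intro multiset_eq_if_truncated_sums_eq) auto
  then show "has_jordan_type scale f P" using Q by simp
qed (use jordan_type_nilpotentD[OF f nil] in blast)

section \<open>Conjugates of unimodal sequences\<close>

text \<open>In an interval, the elements that a shift by \<open>b\<close> moves outside are the last \<open>b\<close> ones.\<close>
lemma card_truncated_interval:
  fixes U :: "nat set"
  assumes fin: "finite U" and conv: "\<And>u v w. u \<in> U \<Longrightarrow> w \<in> U \<Longrightarrow> u \<le> v \<Longrightarrow> v \<le> w \<Longrightarrow> v \<in> U"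
  shows "card {u \<in> U. u + b \<notin> U} = min b (card U)"
proof (cases "U = {}")
  case False
  define e where "e = Max U"
  define a where "a = Min U"
  have ae: "a \<in> U" "e \<in> U" "a \<le> e" using False fin by (auto simp: a_def e_def)
  have U: "U = {a..e}"
  proof
    show "U \<subseteq> {a..e}" using fin by (auto simp: a_def e_def)
    show "{a..e} \<subseteq> U" using conv[OF ae(1,2)] by auto
  qed
  have "{u \<in> U. u + b \<notin> U} = {max a (Suc e - b)..e}" using ae(3) by (auto simp: U)
  then show ?thesis using ae(3) by (simp add: U)
qed simp

lemma unimodal_superlevel_convex:
  assumes "unimodal h j" "u \<le> v" "v \<le> w" "w \<le> j" "i \<le> h u" "i \<le> h w"
  shows "i \<le> h v"
proof -
  obtain c where c: "\<forall>u v. u \<le> v \<and> v \<le> c \<longrightarrow> h u \<le> h v"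
    "\<forall>u v. c \<le> u \<and> u \<le> v \<and> v \<le> j \<longrightarrow> h v \<le> h u"
    using assms(1) unfolding unimodal_def by blast
  show ?thesis
  proof (cases "v \<le> c")
    case True then show ?thesis using c(1) assms by (meson le_trans)
  next
    case False then show ?thesis using c(2) assms by (meson le_trans nat_le_linear)
  qed
qed

text \<open>Both sides count the pairs \<open>(u, i)\<close> with \<open>h (u + b) < i \<le> h u\<close>. For fixed \<open>i\<close> these are
the \<open>u\<close> that a shift by \<open>b\<close> moves out of the superlevel set of \<open>i\<close>, whose size is a part of the
conjugate partition and which is an interval by unimodality.\<close>
lemma conjugate_partition_truncated_sum:
  assumes uni: "unimodal h j" and above: "\<And>u. u > j \<Longrightarrow> h u = 0"
  shows "(\<Sum>p\<in>#conjugate_partition h j. min b p) = (\<Sum>u\<le>j. h u - h (u + b))"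
proof -
  define M where "M = Max (h ` {..j})"
  have hM: "h u \<le> M" if "u \<le> j" for u using that unfolding M_def by (intro Max_ge) auto
  define U where "U i = {u. u \<le> j \<and> i \<le> h u}" for i
  have "(\<Sum>p\<in>#conjugate_partition h j. min b p) = (\<Sum>i=1..M. min b (card (U i)))"
    unfolding conjugate_partition_def M_def U_def by (simp add: sum_unfold_sum_mset image_mset.compositionality o_def)
  also have "\<dots> = (\<Sum>i=1..M. card {u \<in> {..j}. h (u + b) < i \<and> i \<le> h u})"
  proof (rule sum.cong[OF refl])
    fix i assume i: "i \<in> {1..M}"
    have "finite (U i)" by (simp add: U_def)
    moreover have "v \<in> U i" if "u \<in> U i" "w \<in> U i" "u \<le> v" "v \<le> w" for u v w
      using that unimodal_superlevel_convex[OF uni, of u v w i] by (auto simp: U_def)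
    ultimately have "min b (card (U i)) = card {u \<in> U i. u + b \<notin> U i}"
      using card_truncated_interval[of "U i" b] by metis
    also have "{u \<in> U i. u + b \<notin> U i} = {u \<in> {..j}. h (u + b) < i \<and> i \<le> h u}"
      using above[of "_ + b"] i by (fastforce simp: U_def not_le)
    finally show "min b (card (U i)) = card {u \<in> {..j}. h (u + b) < i \<and> i \<le> h u}" .
  qed
  also have "\<dots> = (\<Sum>u\<le>j. card {i \<in> {1..M}. h (u + b) < i \<and> i \<le> h u})"
    using sum.swap_restrict[of "{1..M}" "{..j}" "\<lambda>_ _. 1::nat" "\<lambda>i u. h (u + b) < i \<and> i \<le> h u"]
    by simp
  also have "\<dots> = (\<Sum>u\<le>j. h u - h (u + b))"
  proof (rule sum.cong[OF refl])
    fix u assume "u \<in> {..j}"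
    then have "{i \<in> {1..M}. h (u + b) < i \<and> i \<le> h u} = {h (u + b)<..h u}"
      using hM[of u] by auto
    then show "card {i \<in> {1..M}. h (u + b) < i \<and> i \<le> h u} = h u - h (u + b)" by simp
  qed
  finally show ?thesis .
qed

lemma zero_notin_conjugate_partition: "0 \<notin># conjugate_partition h j"
proof
  assume "0 \<in># conjugate_partition h j"
  then obtain i where i: "i \<le> Max (h ` {..j})" "card {u. u \<le> j \<and> i \<le> h u} = 0"
    unfolding conjugate_partition_def by auto
  have "Max (h ` {..j}) \<in> h ` {..j}" by (rule Max_in) auto
  then obtain u where "u \<le> j" "h u = Max (h ` {..j})" by (metis atMost_iff imageE)
  then have "u \<in> {u. u \<le> j \<and> i \<le> h u}" using i(1) by simp
  moreover have "finite {u. u \<le> j \<and> i \<le> h u}" by simp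
  ultimately show False using i(2) by (metis card_0_eq empty_iff)
qed

text \<open>The comparison of \<open>h u\<close> with \<open>h (u + b)\<close> changes at most once. After the first \<open>t\<close> with
\<open>h (t + b) < h t\<close> the point \<open>t + b\<close> is beyond the peak, so \<open>h (u + b)\<close> can only fall, whereas \<open>h u\<close>
does not fall as long as \<open>u\<close> is before the peak. Beyond the peak the inequality is clear.\<close>
lemma unimodal_shift_crossing:
  assumes uni: "unimodal h j" and above: "\<And>u. u > j \<Longrightarrow> h u = 0"
  obtains t where "\<And>u. u < t \<Longrightarrow> h u \<le> h (u + b)" "\<And>u. t \<le> u \<Longrightarrow> h (u + b) \<le> h u"
proof -
  obtain c where c: "\<forall>u v. u \<le> v \<and> v \<le> c \<longrightarrow> h u \<le> h v"
    "\<forall>u v. c \<le> u \<and> u \<le> v \<and> v \<le> j \<longrightarrow> h v \<le> h u"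
    using uni unfolding unimodal_def by blast
  have d: "h v \<le> h u" if "c \<le> u" "u \<le> v" for u v
    using that c(2) above[of v] by (cases "v \<le> j") auto
  \<comment> \<open>\<open>Suc j\<close> is the default if there is no strict descent: \<open>h\<close> vanishes from there on\<close>
  define t where "t = (LEAST u. u = Suc j \<or> h (u + b) < h u)"
  have t: "t = Suc j \<or> h (t + b) < h t" unfolding t_def by (rule LeastI[of _ "Suc j"]) simp
  show ?thesis
  proof
    show "h u \<le> h (u + b)" if "u < t" for u
      using not_less_Least[of u "\<lambda>u. u = Suc j \<or> h (u + b) < h u"] that t_def by auto
    show "h (u + b) \<le> h u" if u: "t \<le> u" for u
      using t
    proof
      assume "t = Suc j"
      then show ?thesis using u above[of "u + b"] by simp
    next
      assume lt: "h (t + b) < h t"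
      have cb: "c \<le> t + b" using spec[OF spec[OF c(1)], of t "t + b"] lt by linarith
      show ?thesis
      proof (cases "c \<le> u")
        case True then show ?thesis by (rule d) simp
      next
        case False
        have "h (u + b) \<le> h (t + b)" using cb u by (intro d) auto
        also have "\<dots> \<le> h u" using lt spec[OF spec[OF c(1)], of t u] u False by linarith
        finally show ?thesis .
      qed
    qed
  qed
qed

section \<open>Components and the degree filtration\<close>

context standard_graded_artinian_algebra
begin

definition basis where
  "basis = (SOME B. finite B \<and> independent B \<and> span B = UNIV)"

sublocale finite_dimensional_vector_space scale basis
proof -
  obtain B where B: "finite B" "span B = UNIV" using finite_dimensional by blast
  obtain C where C: "C \<subseteq> B" "independent C" "B \<subseteq> span C"
    using maximal_independent_subset[of B] by blast
  have "span C = UNIV"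
    using span_minimal[OF C(3) subspace_span] B(2) by auto
  then have "\<exists>B. finite B \<and> independent B \<and> span B = UNIV"
    using C B(1) finite_subset by blast
  from someI_ex[OF this, folded basis_def]
  show "finite_dimensional_vector_space scale basis" by unfold_locales auto
qed

lemma linear_mult: "Vector_Spaces.linear scale scale ((*) l)"
  by unfold_locales (auto simp: distrib_left scale_mult_left[symmetric] mult.commute[of l])

lemma funpow_mult:
  fixes l x :: "'c::monoid_mult"
  shows "((*) l ^^ b) x = l ^ b * x"
  by (induction b) (auto simp: mult.assoc)

definition component :: "'a \<Rightarrow> nat \<Rightarrow> 'a" where
  "component x = (THE a. (\<forall>i. a i \<in> A i) \<and> x = (\<Sum>i\<le>j. a i))"

lemma component_in_piece: "component x i \<in> A i" and sum_component: "(\<Sum>i\<le>j. component x i) = x"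
  using theI'[OF direct_sum[of x]] unfolding component_def by auto

lemma component_eqI:
  assumes "\<And>i. a i \<in> A i" "x = (\<Sum>i\<le>j. a i)"
  shows "component x = a"
  using direct_sum[of x] assms component_in_piece sum_component by metis

lemma component_add: "component (x + y) i = component x i + component y i"
  by (subst component_eqI[of "\<lambda>i. component x i + component y i"])
    (auto simp: sum.distrib sum_component component_in_piece subspace_piece subspace_add)

lemma component_scale: "component (scale c x) i = scale c (component x i)"
  by (subst component_eqI[of "\<lambda>i. scale c (component x i)"])
    (auto simp: scale_sum_right[symmetric] sum_component component_in_piece subspace_piece subspace_scale)

lemma linear_component: "Vector_Spaces.linear scale scale (\<lambda>x. component x i)"
  by unfold_locales (auto simp: component_add component_scale)

lemma component_0 [simp]: "component 0 i = 0"
  using component_scale[of 0 0] by simp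

lemma component_diff: "component (x - y) i = component x i - component y i"
  using component_add[of "x - y" y i] by (simp add: algebra_simps)

lemma zero_in_piece [simp]: "0 \<in> A i"
  using subspace_piece subspace_0 by blast

lemma component_homogeneous:
  assumes "x \<in> A i"
  shows "component x m = (if m = i then x else 0)"
proof (cases "i \<le> j")
  case True
  then show ?thesis
    using assms by (subst component_eqI[of "\<lambda>m. if m = i then x else 0"]) (auto simp: sum.delta)
next
  case False
  then show ?thesis using assms piece_above[of i] by auto
qed

lemma component_mult_homogeneous:
  assumes y: "y \<in> A d"
  shows "component (y * x) m = (if d \<le> m then y * component x (m - d) else 0)"
proof -
  have "component (y * x) m = component (\<Sum>i\<le>j. y * component x i) m"
    by (simp add: sum_distrib_left[symmetric] sum_component)
  also have "\<dots> = (\<Sum>i\<le>j. component (y * component x i) m)"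
  proof -
    interpret c: Vector_Spaces.linear scale scale "\<lambda>x. component x m" by (rule linear_component)
    show ?thesis by (rule c.sum)
  qed
  also have "\<dots> = (\<Sum>i\<le>j. if m = d + i then y * component x i else 0)"
    by (simp add: component_homogeneous[OF mult_pieces[OF y component_in_piece]])
  also have "\<dots> = (if d \<le> m then y * component x (m - d) else 0)"
  proof (cases "d \<le> m \<and> m - d \<le> j")
    case True
    then have "(\<Sum>i\<le>j. if m = d + i then y * component x i else 0) =
        (\<Sum>i\<le>j. if i = m - d then y * component x i else 0)"
      by (intro sum.cong) auto
    then show ?thesis using True by (simp add: sum.delta)
  next
    case False
    then have "(\<Sum>i\<le>j. if m = d + i then y * component x i else 0) = 0"
      by (intro sum.neutral) auto
    moreover have "component x (m - d) = 0" if "d \<le> m"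
      using False that component_in_piece[of x "m - d"] piece_above[of "m - d"] by auto
    ultimately show ?thesis by simp
  qed
  finally show ?thesis .
qed

text \<open>The sum of the pieces of degree at least \<open>t\<close>, that is, the \<open>t\<close>-th power of the
maximal ideal.\<close>
definition filt :: "nat \<Rightarrow> 'a set" where
  "filt t = {x. \<forall>i<t. component x i = 0}"

lemma subspace_filt: "subspace (filt t)"
  by (auto simp: subspace_def filt_def component_add component_scale)

lemma piece_subset_filt: "t \<le> i \<Longrightarrow> A i \<subseteq> filt t"
  by (auto simp: filt_def component_homogeneous)

lemma filt_antimono: "s \<le> t \<Longrightarrow> filt t \<subseteq> filt s"
  by (auto simp: filt_def)

lemma filt_top: assumes "j < t" shows "filt t = {0}"
proof -
  have "x = 0" if "x \<in> filt t" for x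
    using that assms sum_component[of x] by (auto simp: filt_def)
  then show ?thesis by (auto simp: filt_def)
qed

lemma filt_mult:
  assumes x: "x \<in> filt s" and y: "y \<in> filt t"
  shows "x * y \<in> filt (s + t)"
proof -
  have "x * y = (\<Sum>i\<le>j. component x i * y)"
    by (simp add: sum_distrib_right[symmetric] sum_component)
  also have "\<dots> \<in> filt (s + t)"
  proof (rule subspace_sum[OF subspace_filt])
    fix i
    show "component x i * y \<in> filt (s + t)"
      using x y component_mult_homogeneous[OF component_in_piece, of x i y]
      by (cases "i < s") (auto simp: filt_def)
  qed
  finally show ?thesis .
qed

lemma minus_component_in_filt: "x \<in> filt t \<Longrightarrow> x - component x t \<in> filt (Suc t)"
  by (auto simp: filt_def component_diff component_homogeneous[OF component_in_piece] less_Suc_eq)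

lemma dim_graded_subspace:
  assumes G: "subspace G" and component: "\<And>x i. x \<in> G \<Longrightarrow> component x i \<in> G"
  shows "dim G = (\<Sum>i\<le>j. dim (G \<inter> A i))"
proof -
  \<comment> \<open>peel off one degree at a time, from the top degree \<open>j\<close> downwards\<close>
  have "dim (G \<inter> filt (Suc j - n)) = (\<Sum>i\<in>{Suc j - n..j}. dim (G \<inter> A i))" if "n \<le> Suc j" for n
    using that
  proof (induction n)
    case 0
    have "G \<inter> {0} = {0}" using G subspace_0 by auto
    then show ?case by (simp add: filt_top)
  next
    case (Suc n)
    define t where "t = j - n"
    have t: "Suc j - Suc n = t" "Suc j - n = Suc t" "t \<le> j" using Suc by (auto simp: t_def)
    have "dim {x + y |x y. x \<in> G \<inter> A t \<and> y \<in> G \<inter> filt (Suc t)}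
        + dim ((G \<inter> A t) \<inter> (G \<inter> filt (Suc t))) = dim (G \<inter> A t) + dim (G \<inter> filt (Suc t))"
      by (intro dim_sums_Int subspace_inter G subspace_piece subspace_filt)
    moreover have "(G \<inter> A t) \<inter> (G \<inter> filt (Suc t)) \<subseteq> {0}"
      by (auto simp: filt_def) (metis component_homogeneous lessI)
    then have "dim ((G \<inter> A t) \<inter> (G \<inter> filt (Suc t))) = 0" by simp
    moreover have "{x + y |x y. x \<in> G \<inter> A t \<and> y \<in> G \<inter> filt (Suc t)} = G \<inter> filt t"
    proof (intro equalityI subsetI)
      fix z assume "z \<in> {x + y |x y. x \<in> G \<inter> A t \<and> y \<in> G \<inter> filt (Suc t)}"
      then show "z \<in> G \<inter> filt t"
        using piece_subset_filt[of t t] filt_antimono[of t "Suc t"]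
        by (auto intro!: subspace_add[OF G] subspace_add[OF subspace_filt])
    next
      fix z assume z: "z \<in> G \<inter> filt t"
      then have "component z t \<in> G \<inter> A t" "z - component z t \<in> G \<inter> filt (Suc t)"
        using component component_in_piece minus_component_in_filt subspace_diff[OF G] by auto
      then show "z \<in> {x + y |x y. x \<in> G \<inter> A t \<and> y \<in> G \<inter> filt (Suc t)}"
        by (intro CollectI exI[of _ "component z t"] exI[of _ "z - component z t"]) auto
    qed
    ultimately have "dim (G \<inter> filt t) = dim (G \<inter> A t) + dim (G \<inter> filt (Suc t))" by simp
    then show ?case
      using Suc t sum.atLeast_Suc_atMost[of t j "\<lambda>i. dim (G \<inter> A i)"] by simp
  qed
  from this[of "Suc j"] show ?thesis by (simp add: filt_def atLeast0AtMost)
qed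

abbreviation h where "h \<equiv> hilbert_function scale A"

lemma h_eq: "h i = dim (A i)"
  by (simp add: hilbert_function_def)

lemma h_above: "j < i \<Longrightarrow> h i = 0"
  by (simp add: h_eq piece_above)

lemma dim_filt: "dim (filt t) = (\<Sum>u=t..j. h u)"
proof -
  have "dim (filt t) = (\<Sum>i\<le>j. dim (filt t \<inter> A i))"
    by (intro dim_graded_subspace subspace_filt)
      (auto simp: filt_def component_homogeneous[OF component_in_piece])
  also have "\<dots> = (\<Sum>i\<le>j. if t \<le> i then h i else 0)"
  proof (rule sum.cong[OF refl])
    fix i
    have "filt t \<inter> A i \<subseteq> {0}" if "i < t"
      using that by (auto simp: filt_def component_homogeneous)
    then show "dim (filt t \<inter> A i) = (if t \<le> i then h i else 0)"
      using piece_subset_filt[of t i] by (auto simp: h_eq Int_absorb1 not_le)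
  qed
  also have "\<dots> = (\<Sum>u=t..j. h u)"
    by (intro sum.mono_neutral_cong_right) auto
  finally show ?thesis .
qed

section \<open>Generation by linear forms\<close>

lemma one_in_piece: "1 \<in> A 0"
  using piece_0 rangeI[of "\<lambda>c. scale c 1" 1] by simp

lemma power_in_piece: "l \<in> A d \<Longrightarrow> l ^ b \<in> A (d * b)"
proof (induction b)
  case (Suc b)
  then show ?case using mult_pieces[of l d "l ^ b" "d * b"] by simp
qed (simp add: one_in_piece)

lemma prod_list_in_piece: "set xs \<subseteq> A 1 \<Longrightarrow> prod_list xs \<in> A (length xs)"
proof (induction xs)
  case (Cons x xs)
  then show ?case using mult_pieces[of x 1 "prod_list xs" "length xs"] by simp
qed (simp add: one_in_piece)

lemma span_monomials: "span (prod_list ` lists (A 1)) = UNIV"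
proof -
  let ?M = "prod_list ` lists (A 1)"
  have "subspace (span ?M)" by simp
  moreover have "1 \<in> span ?M" by (rule span_base) (metis lists.Nil image_eqI prod_list.Nil)
  moreover have "x * y \<in> span ?M" if x: "x \<in> span ?M" and y: "y \<in> span ?M" for x y
  proof -
    have 1: "subspace {z. a * z \<in> span ?M}" for a
    proof -
      interpret l: Vector_Spaces.linear scale scale "(*) a" by (rule linear_mult)
      show ?thesis using l.subspace_vimage[of "span ?M"] by (simp add: vimage_def)
    qed
    have *: "m * y \<in> span ?M" if "m \<in> ?M" for m
    proof -
      have "?M \<subseteq> {z. m * z \<in> span ?M}"
      proof
        fix z assume "z \<in> ?M"
        then obtain xs ys where "z = prod_list xs" "xs \<in> lists (A 1)"
          and "m = prod_list ys" "ys \<in> lists (A 1)"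
          using \<open>m \<in> ?M\<close> by blast
        then have "m * z = prod_list (ys @ xs)" "ys @ xs \<in> lists (A 1)" by auto
        then show "z \<in> {z. m * z \<in> span ?M}" by (metis CollectI image_eqI span_base)
      qed
      from span_minimal[OF this 1] show ?thesis using y by auto
    qed
    have "?M \<subseteq> {z. y * z \<in> span ?M}" using * by (auto simp: mult.commute)
    from span_minimal[OF this 1] show ?thesis using x by (auto simp: mult.commute)
  qed
  moreover have "A 1 \<subseteq> span ?M"
  proof
    fix x assume "x \<in> A 1"
    then have "prod_list [x] \<in> ?M" by (intro imageI) simp
    then show "x \<in> span ?M" using span_base by simp
  qed
  ultimately have "(\<lambda>S. subspace S \<and> 1 \<in> S \<and> (\<forall>x\<in>S. \<forall>y\<in>S. x * y \<in> S)) hull A 1 \<subseteq> span ?M"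
    by (intro hull_minimal) auto
  then show ?thesis using generated_in_degree_1 by (metis top.extremum_uniqueI)
qed

text \<open>Project the spanning set of monomials to degree \<open>i + 1\<close>: only the monomials of that
length survive, and these have a linear factor.\<close>
lemma piece_Suc: "A (Suc i) \<subseteq> span {x * y | x y. x \<in> A 1 \<and> y \<in> A i}"
proof
  let ?T = "span {x * y | x y. x \<in> A 1 \<and> y \<in> A i}"
  let ?S = "{x. component x (Suc i) \<in> ?T}"
  fix x assume x: "x \<in> A (Suc i)"
  have "subspace ?S"
    by (auto simp: subspace_def component_add component_scale span_add span_scale span_zero)
  moreover have "prod_list ` lists (A 1) \<subseteq> ?S"
  proof (intro image_subsetI CollectI)
    fix xs assume "xs \<in> lists (A 1)"
    then have xs: "set xs \<subseteq> A 1" by auto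
    show "component (prod_list xs) (Suc i) \<in> ?T"
    proof (cases "length xs = Suc i")
      case True
      then obtain y ys where ys: "xs = y # ys" by (cases xs) auto
      then have "y \<in> A 1" "prod_list ys \<in> A i"
        using xs True prod_list_in_piece[of ys] by auto
      then have "prod_list xs \<in> ?T" using ys by (intro span_base) auto
      then show ?thesis
        using True component_homogeneous[OF prod_list_in_piece[OF xs]] by simp
    next
      case False
      then show ?thesis
        using component_homogeneous[OF prod_list_in_piece[OF xs]] by (simp add: span_zero)
    qed
  qed
  ultimately have "span (prod_list ` lists (A 1)) \<subseteq> ?S" by (rule span_minimal[rotated])
  then have "component x (Suc i) \<in> ?T" using span_monomials by auto
  then show "x \<in> ?T" using component_homogeneous[OF x] by simp
qed

text \<open>Since every piece of positive degree is spanned by multiples of linear forms, an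
element killed by the linear forms lies in the socle.\<close>
lemma annihilated_by_filt_1:
  assumes ann: "\<And>y. y \<in> A 1 \<Longrightarrow> y * x = 0" and l: "l \<in> filt 1"
  shows "l * x = 0"
proof -
  have *: "y * x = 0" if "y \<in> A (Suc i)" for i y
  proof -
    have "{u * v | u v. u \<in> A 1 \<and> v \<in> A i} \<subseteq> {y. x * y = 0}"
    proof clarify
      fix u v assume "u \<in> A 1"
      then have "u * x = 0" by (rule ann)
      then show "x * (u * v) = 0" by (metis mult.assoc mult.commute mult_zero_left)
    qed
    moreover have "subspace {y. x * y = 0}"
    proof -
      interpret l: Vector_Spaces.linear scale scale "(*) x" by (rule linear_mult)
      show ?thesis by (rule l.subspace_kernel)
    qed
    ultimately have "A (Suc i) \<subseteq> {y. x * y = 0}"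
      using piece_Suc[of i] span_minimal by blast
    then show ?thesis using that by (auto simp: mult.commute)
  qed
  have "component l i * x = 0" for i
    using l *[OF component_in_piece] by (cases i) (auto simp: filt_def)
  then show ?thesis using sum_component[of l] by (metis (no_types, lifting) sum.neutral sum_distrib_right)
qed

section \<open>Lefschetz elements and kernels of powers\<close>

lemma maximal_ideal_eq_filt: "maximal_ideal A j = filt 1"
proof (intro equalityI subsetI)
  fix x assume "x \<in> maximal_ideal A j"
  then obtain a where a: "x = (\<Sum>i=1..j. a i)" "\<forall>i\<in>{1..j}. a i \<in> A i"
    unfolding maximal_ideal_def by blast
  show "x \<in> filt 1" unfolding a(1)
  proof (rule subspace_sum[OF subspace_filt])
    fix i assume "i \<in> {1..j}"
    then show "a i \<in> filt 1" using a(2) piece_subset_filt[of 1 i] by auto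
  qed
next
  fix x assume x: "x \<in> filt 1"
  have "x = (\<Sum>i=1..j. component x i)"
    using x sum_component[of x]
    by (simp add: filt_def atLeast0AtMost[symmetric] sum.atLeast_Suc_atMost)
  then show "x \<in> maximal_ideal A j" unfolding maximal_ideal_def using component_in_piece by blast
qed

lemma power_in_filt: "l \<in> filt 1 \<Longrightarrow> l ^ b \<in> filt b"
proof (induction b)
  case 0 show ?case by (simp add: filt_def)
next
  case (Suc b)
  then show ?case using filt_mult[of l 1 "l ^ b" b] by simp
qed

theorem has_jordan_type_mult_iff:
  assumes l: "l \<in> filt 1"
  shows "has_jordan_type scale ((*) l) P \<longleftrightarrow>
    0 \<notin># P \<and> (\<forall>b. (\<Sum>p\<in>#P. min b p) = dim {x. l ^ b * x = 0})"
proof -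
  have "((*) l ^^ Suc j) x = 0" for x
    using power_in_filt[OF l, of "Suc j"] filt_top[of "Suc j"] by (simp only: funpow_mult) simp
  from has_jordan_type_nilpotent_iff[OF linear_mult this] show ?thesis
    by (simp add: funpow_mult)
qed

text \<open>The reformulation of strong Lefschetz Jordan type on which both directions rest; the
right-hand side is the dimension that the kernel has when \<open>l\<^sup>b\<close> is homogeneous and of maximal
rank in each degree.\<close>
lemma strong_lefschetz_jordan_type_iff:
  assumes "unimodal h j"
  shows "has_strong_lefschetz_jordan_type scale A j l \<longleftrightarrow>
    l \<in> filt 1 \<and> (\<forall>b. dim {x. l ^ b * x = 0} = (\<Sum>u\<le>j. h u - h (u + b)))"
  using has_jordan_type_mult_iff[of l]
    conjugate_partition_truncated_sum[OF assms h_above] zero_notin_conjugate_partition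
  unfolding has_strong_lefschetz_jordan_type_def maximal_ideal_eq_filt by auto

lemma subspace_annihilator: "subspace {x. l * x = 0}"
proof -
  interpret l: Vector_Spaces.linear scale scale "(*) l" by (rule linear_mult)
  show ?thesis by (rule l.subspace_kernel)
qed

text \<open>The kernel of a homogeneous element is graded, so that its dimension is the sum of the
defects of the ranks in the single degrees.\<close>
lemma strong_lefschetz_element_jordan_type:
  assumes uni: "unimodal h j" and sl: "strong_lefschetz_element scale A j l"
  shows "has_strong_lefschetz_jordan_type scale A j l"
proof -
  have l: "l \<in> A 1" using sl by (simp add: strong_lefschetz_element_def)
  have "dim {x. l ^ b * x = 0} = (\<Sum>u\<le>j. h u - h (u + b))" for b
  proof -
    have lb: "l ^ b \<in> A b" using power_in_piece[OF l, of b] by simp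
    have "dim {x. l ^ b * x = 0} = (\<Sum>i\<le>j. dim ({x. l ^ b * x = 0} \<inter> A i))"
    proof (rule dim_graded_subspace[OF subspace_annihilator])
      fix x i assume "x \<in> {x. l ^ b * x = 0}"
      then show "component x i \<in> {x. l ^ b * x = 0}"
        using component_mult_homogeneous[OF lb, of x "i + b"] by simp
    qed
    also have "\<dots> = (\<Sum>u\<le>j. h u - h (u + b))"
    proof (rule sum.cong[OF refl])
      fix u assume u: "u \<in> {..j}"
      have rank: "dim ((\<lambda>x. l ^ b * x) ` A u) = min (h u) (h (u + b))"
      proof (cases "u < j")
        case True then show ?thesis using sl by (simp add: strong_lefschetz_element_def h_eq)
      next
        \<comment> \<open>in the top degree the rank is maximal for trivial reasons\<close>
        case False
        show ?thesis
        proof (cases "b = 0")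
          case True then show ?thesis by (simp add: h_eq)
        next
          case b: False
          have "(\<lambda>x. l ^ b * x) ` A u \<subseteq> A (b + u)" using mult_pieces[OF lb] by auto
          also have "\<dots> = {0}" using b False u by (intro piece_above) auto
          finally show ?thesis using b False u h_above[of "u + b"] by simp
        qed
      qed
      have "{x. l ^ b * x = 0} \<inter> A u = {x \<in> A u. l ^ b * x = 0}" by auto
      then show "dim ({x. l ^ b * x = 0} \<inter> A u) = h u - h (u + b)"
        using rank_nullity_subspace[OF linear_mult[of "l ^ b"] subspace_piece[of u]] rank
        by (simp add: h_eq)
    qed
    finally show ?thesis .
  qed
  then show ?thesis
    using strong_lefschetz_jordan_type_iff[OF uni] l piece_subset_filt[of 1 1] by auto
qed

section \<open>The linear part of an element of strong Lefschetz Jordan type\<close>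

text \<open>As \<open>l\<close> has no constant term, its linear part is its term of lowest possible degree, and such
terms multiply: any other product of components of \<open>l\<close> has larger degree.\<close>
lemma power_minus_leading_form:
  assumes l: "l \<in> filt 1"
  shows "l ^ b - component l 1 ^ b \<in> filt (Suc b)"
proof (induction b)
  case 0 show ?case using subspace_0[OF subspace_filt] by simp
next
  case (Suc b)
  have 1: "l * (l ^ b - component l 1 ^ b) \<in> filt (1 + Suc b)" by (rule filt_mult[OF l Suc])
  have "component l 1 ^ b \<in> filt b"
    using component_in_piece piece_subset_filt by (intro power_in_filt) blast
  then have 2: "(l - component l 1) * component l 1 ^ b \<in> filt (Suc 1 + b)"
    by (rule filt_mult[OF minus_component_in_filt[OF l]])
  have "l ^ Suc b - component l 1 ^ Suc b =
      l * (l ^ b - component l 1 ^ b) + (l - component l 1) * component l 1 ^ b"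
    by (simp add: algebra_simps)
  then show ?case using subspace_add[OF subspace_filt, of _ "Suc (Suc b)"] 1 2 by simp
qed

text \<open>With \<open>t\<close> the degree at which the comparison of \<open>h u\<close> and \<open>h (u + b)\<close> changes, the sum
collapses to \<open>dim (filt t) - dim (filt (t + b))\<close>. By rank-nullity, already the kernel of \<open>l\<^sup>b\<close> on
\<open>filt t\<close> has at least this dimension, with equality only if \<open>filt t\<close> maps onto \<open>filt (t + b)\<close>.\<close>
lemma extremal_kernel_and_image:
  assumes l: "l \<in> filt 1"
    and inc: "\<And>u. u < t \<Longrightarrow> h u \<le> h (u + b)" and dec: "\<And>u. t \<le> u \<Longrightarrow> h (u + b) \<le> h u"
    and ker: "dim {x. l ^ b * x = 0} = (\<Sum>u\<le>j. h u - h (u + b))"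
  shows "{x. l ^ b * x = 0} \<subseteq> filt t" and "(*) (l ^ b) ` filt t = filt (t + b)"
proof -
  let ?K = "{x. l ^ b * x = 0}" and ?Kt = "{x \<in> filt t. l ^ b * x = 0}" and ?I = "(*) (l ^ b) ` filt t"
  have shift: "(\<Sum>u=t..j. h (u + b)) = (\<Sum>u=t+b..j. h u)"
  proof -
    have "(\<Sum>u=t..j. h (u + b)) = (\<Sum>u=t+b..j+b. h u)"
      by (rule sum.shift_bounds_cl_nat_ivl[symmetric])
    also have "\<dots> = (\<Sum>u=t+b..j. h u)"
      using h_above by (intro sum.mono_neutral_right) auto
    finally show ?thesis .
  qed
  have "(\<Sum>u\<le>j. h u - h (u + b)) = (\<Sum>u=t..j. h u - h (u + b))"
    using inc by (intro sum.mono_neutral_right) auto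
  then have "dim ?K + dim (filt (t + b)) = (\<Sum>u=t..j. (h u - h (u + b)) + h (u + b))"
    unfolding ker dim_filt shift[symmetric] sum.distrib by simp
  also have "\<dots> = dim (filt t)"
    unfolding dim_filt using dec by (intro sum.cong) auto
  finally have dims: "dim ?K + dim (filt (t + b)) = dim (filt t)" .
  have rn: "dim ?Kt + dim ?I = dim (filt t)"
    by (rule rank_nullity_subspace[OF linear_mult subspace_filt])
  have IF: "?I \<subseteq> filt (t + b)"
    using filt_mult[OF power_in_filt[OF l]] by (auto simp: add.commute[of t b])
  have KK: "?Kt \<subseteq> ?K" by auto
  note le = dim_subset[OF IF] dim_subset[OF KK]
  have sKt: "subspace ?Kt"
  proof -
    have "?Kt = filt t \<inter> ?K" by auto
    then show ?thesis by (simp add: subspace_inter subspace_filt subspace_annihilator)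
  qed
  have "?Kt = ?K"
    using subspace_dim_equal[OF sKt subspace_annihilator KK] le dims rn by linarith
  then show "?K \<subseteq> filt t" by auto
  have sI: "subspace ?I"
  proof -
    interpret l: Vector_Spaces.linear scale scale "(*) (l ^ b)" by (rule linear_mult)
    show ?thesis by (rule l.subspace_image[OF subspace_filt])
  qed
  show "?I = filt (t + b)"
    using subspace_dim_equal[OF sI subspace_filt IF] le dims rn by linarith
qed

text \<open>In degree \<open>t\<close>, compare components of degree \<open>t + b\<close>. Higher degrees follow by
multiplying with linear forms, as these generate the algebra.\<close>
lemma leading_form_surjective:
  assumes l: "l \<in> filt 1" and sur: "(*) (l ^ b) ` filt t = filt (t + b)" and i: "t \<le> i"
  shows "(*) (component l 1 ^ b) ` A i = A (i + b)"
  using i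
proof (induction i rule: dec_induct)
  case base
  let ?g = "component l 1 ^ b"
  have g: "?g \<in> A b" using power_in_piece[OF component_in_piece, of l 1 b] by simp
  show ?case
  proof (intro equalityI subsetI)
    fix y assume "y \<in> (*) ?g ` A t"
    then show "y \<in> A (t + b)" using mult_pieces[OF g] by (auto simp: add.commute[of t b])
  next
    fix y assume y: "y \<in> A (t + b)"
    then obtain x where x: "x \<in> filt t" "y = l ^ b * x"
      using sur piece_subset_filt[of "t + b" "t + b"] by blast
    have "y - ?g * x = (l ^ b - ?g) * x" by (simp add: x algebra_simps)
    then have "y - ?g * x \<in> filt (Suc b + t)"
      using filt_mult[OF power_minus_leading_form[OF l] x(1)] by simp
    then have "component (y - ?g * x) (t + b) = 0" by (simp add: filt_def)
    then have "y = ?g * component x t"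
      using component_mult_homogeneous[OF g, of x "t + b"] component_homogeneous[OF y]
      by (simp add: component_diff)
    then show "y \<in> (*) ?g ` A t" using component_in_piece by auto
  qed
next
  case (step i)
  let ?g = "component l 1 ^ b"
  have g: "?g \<in> A b" using power_in_piece[OF component_in_piece, of l 1 b] by simp
  interpret g: Vector_Spaces.linear scale scale "(*) ?g" by (rule linear_mult)
  show ?case
  proof
    show "(*) ?g ` A (Suc i) \<subseteq> A (Suc i + b)"
      using mult_pieces[OF g, of _ "Suc i"] by (auto simp: add.commute[of _ b])
    have "{x * y | x y. x \<in> A 1 \<and> y \<in> A (i + b)} \<subseteq> (*) ?g ` A (Suc i)"
    proof clarify
      fix x y assume x: "x \<in> A 1" and "y \<in> A (i + b)"
      then obtain z where z: "z \<in> A i" "y = ?g * z" using step.IH by blast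
      then have "x * y = ?g * (x * z)" "x * z \<in> A (Suc i)"
        using mult_pieces[OF x z(1)] by (auto simp: algebra_simps)
      then show "x * y \<in> (*) ?g ` A (Suc i)" by blast
    qed
    then have "span {x * y | x y. x \<in> A 1 \<and> y \<in> A (i + b)} \<subseteq> (*) ?g ` A (Suc i)"
      by (rule span_minimal[OF _ g.subspace_image[OF subspace_piece]])
    then show "A (Suc i + b) \<subseteq> (*) ?g ` A (Suc i)" using piece_Suc[of "i + b"] by simp
  qed
qed

text \<open>Induction on the distance of \<open>i\<close> from the top degree \<open>t - 1\<close>. In degree \<open>t - 1\<close>, the
element \<open>l\<^sup>b x\<close> has only components of degree at least \<open>t + b\<close>, so by surjectivity \<open>x\<close> differs
from an element of \<open>filt t\<close> by an element of the kernel of \<open>l\<^sup>b\<close>, and so lies in \<open>filt t\<close>. In lower degrees, the products of \<open>x\<close> with linear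
forms vanish by induction, hence \<open>x\<close> is killed by \<open>l\<close>, and the kernel contains no nonzero
homogeneous elements of degree below \<open>t\<close>.\<close>
lemma leading_form_injective:
  assumes l: "l \<in> filt 1" and b: "0 < b" and sur: "(*) (l ^ b) ` filt t = filt (t + b)"
    and ker: "{x. l ^ b * x = 0} \<subseteq> filt t"
    and "x \<in> A i" "i < t" "component l 1 ^ b * x = 0"
  shows "x = 0"
proof -
  have zero: "x = 0" if "x \<in> A i" "i < t" "l ^ b * x = 0" for x i
  proof -
    have "component x i = 0" using ker that by (auto simp: filt_def)
    then show ?thesis using component_homogeneous[OF that(1)] by simp
  qed
  obtain n where "t = Suc (i + n)" using less_imp_Suc_add[OF \<open>i < t\<close>] by blast
  then show ?thesis using assms(5,7)
  proof (induction n arbitrary: i x)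
    case 0
    have "l ^ b * x = (l ^ b - component l 1 ^ b) * x" using 0 by (simp add: algebra_simps)
    also have "\<dots> \<in> filt (Suc b + i)"
      using power_minus_leading_form[OF l] piece_subset_filt[of i i] 0(2) by (intro filt_mult) auto
    finally have "l ^ b * x \<in> (*) (l ^ b) ` filt t" using sur 0(1) by (simp add: add.commute)
    then obtain y where y: "y \<in> filt t" "l ^ b * x = l ^ b * y" by blast
    then have "x - y \<in> filt t" using ker by (auto simp: right_diff_distrib)
    then have "x \<in> filt t" using subspace_add[OF subspace_filt _ y(1), of "x - y"] by simp
    then have "component x i = 0" using 0(1) by (simp add: filt_def)
    then show ?case using component_homogeneous[OF 0(2)] by simp
  next
    case (Suc n)
    have "y * x = 0" if y: "y \<in> A 1" for y
    proof (rule Suc.IH)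
      show "t = Suc (Suc i + n)" using Suc by simp
      show "y * x \<in> A (Suc i)" using mult_pieces[OF y Suc.prems(2)] by simp
      show "component l 1 ^ b * (y * x) = 0" using Suc.prems(3) by (simp add: mult.left_commute)
    qed
    then have "l * x = 0" using l by (rule annihilated_by_filt_1)
    then have "l ^ b * x = 0"
      using b by (metis Suc_pred mult.assoc mult.commute mult_zero_right power_Suc)
    then show ?case using zero[OF Suc.prems(2)] Suc.prems(1) by simp
  qed
qed

lemma leading_form_strong_lefschetz:
  assumes uni: "unimodal h j" and slj: "has_strong_lefschetz_jordan_type scale A j l"
  shows "strong_lefschetz_element scale A j (component l 1)"
  unfolding strong_lefschetz_element_def
proof (intro conjI allI impI)
  show "component l 1 \<in> A 1" by (rule component_in_piece)
  fix i b
  let ?g = "component l 1 ^ b"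
  have l: "l \<in> filt 1" and ker: "dim {x. l ^ b * x = 0} = (\<Sum>u\<le>j. h u - h (u + b))"
    using slj strong_lefschetz_jordan_type_iff[OF uni] by auto
  show "dim ((*) ?g ` A i) = min (dim (A i)) (dim (A (i + b)))"
  proof (cases "b = 0")
    case True then show ?thesis by simp
  next
    case False
    obtain t where t: "\<And>u. u < t \<Longrightarrow> h u \<le> h (u + b)"
      "\<And>u. t \<le> u \<Longrightarrow> h (u + b) \<le> h u"
      using unimodal_shift_crossing[OF uni h_above] by metis
    note cross = extremal_kernel_and_image[of l t b, OF l t ker]
    show ?thesis
    proof (cases "i < t")
      case True
      have "{x \<in> A i. ?g * x = 0} \<subseteq> {0}"
        using leading_form_injective[OF l _ cross(2,1) _ True] False by auto
      then have "dim {x \<in> A i. ?g * x = 0} = 0" by (simp only: dim_eq_0)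
      then have "dim ((*) ?g ` A i) = dim (A i)"
        using rank_nullity_subspace[OF linear_mult[of ?g] subspace_piece[of i]] by linarith
      then show ?thesis using t(1)[OF True] by (simp add: h_eq)
    next
      case False
      then show ?thesis
        using leading_form_surjective[OF l cross(2), of i] t(2)[of i] by (simp add: h_eq)
    qed
  qed
qed

end

theorem proposition2p14:
  fixes scale :: "'k::field \<Rightarrow> 'a::comm_ring_1 \<Rightarrow> 'a"
    and A :: "nat \<Rightarrow> 'a set" and j :: nat
  assumes "standard_graded_artinian_algebra scale A j"
    and "unimodal (hilbert_function scale A) j"
  shows "(\<exists>l. has_strong_lefschetz_jordan_type scale A j l) \<longleftrightarrow>
         (\<exists>l. strong_lefschetz_element scale A j l)"
proof -
  interpret standard_graded_artinian_algebra scale A j by (rule assms(1))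
  show ?thesis
    using leading_form_strong_lefschetz[OF assms(2)] strong_lefschetz_element_jordan_type[OF assms(2)]
    by blast
qed

end
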